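(* Let $P$ be an oriented simplicial polyhedron in $\mathbb{R}^n$ with nonzero volume $V(P)$. For a point $O$ not belonging to any of the hyperplanes of the facets of $P$, and for each facet $F$ of $P$, let $C_F$ be the circumcenter of the simplex with vertex $O$ and base $F$, and let $V_F$ be the signed volume of this simplex. Then the Circumcenter of Mass $$ CCM(P)=\sum_{F\subset\partial P}\frac{V_F}{V(P)}\,C_F $$ (sum over all facets of $P$) is well defined, that is, does not depend on the choice of the point $O$.
   Context: An oriented simplicial polyhedron $P$ in $\mathbb{R}^n$ is one whose facets are nondegenerate $(n-1)$-dimensional simplices; each facet is written $F=(V_1,\dots,V_n)$ with its vertices ordered compatibly with the orientation of $\partial P$, so that $\partial P=\sum F$ is an $(n-1)$-dimensional simplicial cycle. The signed volume of the simplex with vertex $O$ and base $F=(V_1,\dots,V_n)$ is $V_F=\frac{1}{n!}\det(V_1-O,\dots,V_n-O)$, and $V(P)=\sum_F V_F$ is the signed volume of $P$ (independent of $O$). The circumcenter of an $n$-simplex in $\mathbb{R}^n$ is the point equidistant from its $n+1$ vertices. *)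

theory Defs
  imports "HOL-Analysis.Analysis" "HOL-Combinatorics.Permutations" "HOL-Library.Multiset"
begin

text \<open>
  An oriented simplex is a list of vertices. Even permutations of the list give the same
  oriented simplex, odd permutations give its negative. The linear order on the index type
  \<open>'n\<close> identifies it with \<open>{1..n}\<close>, so that the vertex lists can serve as rows of a matrix.
\<close>

text \<open>
  The coefficient of the oriented simplex \<open>G\<close> in the oriented simplex \<open>H\<close>: the sign of the
  permutation taking \<open>G\<close> to \<open>H\<close>, and 0 if there is none. For a list \<open>G\<close> with
  repetitions the sum cancels to 0, as it should for a degenerate simplex.
\<close>
definition oriented_coeff :: "'a list \<Rightarrow> 'a list \<Rightarrow> int" where
  "oriented_coeff G H =
     (\<Sum>p | p permutes {..<length G} \<and> permute_list p G = H. sign p)"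

text \<open>
  The coefficient of \<open>G\<close> in the boundary
  \<open>\<Sum>i. (-1)^i (V\<^sub>0, \<dots>, V\<^sub>i\<^sub>-\<^sub>1, V\<^sub>i\<^sub>+\<^sub>1, \<dots>)\<close> of the oriented simplex \<open>F\<close>.
\<close>
definition boundary_coeff :: "'a list \<Rightarrow> 'a list \<Rightarrow> int" where
  "boundary_coeff G F =
     (\<Sum>i<length F. (-1) ^ i * oriented_coeff G (take i F @ drop (Suc i) F))"

text \<open>The chain \<open>\<Sum>F\<in>#P. F\<close> has zero boundary.\<close>
definition simplicial_cycle :: "'a list multiset \<Rightarrow> bool" where
  "simplicial_cycle P \<longleftrightarrow> (\<forall>G. (\<Sum>F\<in>#P. boundary_coeff G F) = 0)"

text \<open>
  A polyhedron is given by its oriented facets. It may be self-intersecting, and facets may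
  coincide as point sets, hence the multiset.
\<close>
definition oriented_simplicial_polyhedron ::
    "(real ^ 'n::{finite,linorder}) list multiset \<Rightarrow> bool" where
  "oriented_simplicial_polyhedron P \<longleftrightarrow>
     (\<forall>F\<in>#P. length F = CARD('n) \<and> distinct F \<and> \<not> affine_dependent (set F)) \<and>
     simplicial_cycle P"

text \<open>\<open>card {..<i}\<close> is the zero-based position of the index \<open>i\<close>.\<close>
definition simplex_volume ::
    "real ^ 'n::{finite,linorder} \<Rightarrow> (real ^ 'n::{finite,linorder}) list \<Rightarrow> real" where
  "simplex_volume Q F = det (\<chi> i. F ! card {..<i} - Q) / fact CARD('n)"

text \<open>The common value, for all apexes \<open>Q\<close>, of the sum of the signed volumes.\<close>
definition polyhedron_volume ::
    "(real ^ 'n::{finite,linorder}) list multiset \<Rightarrow> real" where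
  "polyhedron_volume P = (THE v. \<forall>Q. (\<Sum>F\<in>#P. simplex_volume Q F) = v)"

text \<open>Meant for the \<open>n + 1\<close> vertices of an \<open>n\<close>-simplex in \<open>n\<close>-space, where the point is unique.\<close>
definition circumcenter :: "'a::metric_space set \<Rightarrow> 'a" where
  "circumcenter S = (THE c. \<exists>r. \<forall>v\<in>S. dist c v = r)"

definition circumcenter_of_mass ::
    "(real ^ 'n::{finite,linorder}) list multiset \<Rightarrow> real ^ 'n::{finite,linorder} \<Rightarrow> real ^ 'n::{finite,linorder}" where
  "circumcenter_of_mass P Q =
     (\<Sum>F\<in>#P. (simplex_volume Q F / polyhedron_volume P) *\<^sub>R circumcenter (insert Q (set F)))"

end

(*
  Write F = (V_1, ..., V_n). By Cramer's rule, n! V_F times the k-th coordinate of C_F is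
  det(h(V_1) - h(O), ..., h(V_n) - h(O)), where h replaces the k-th coordinate of x by |x|^2 / 2.
  By multilinearity this equals det(h(V_1), ..., h(V_n)) minus the sum over j of the determinants
  whose j-th row is replaced by w = h(O). The latter sum is the value on the boundary of F of the
  alternating function (W_1, ..., W_{n-1}) |-> det(w, h(W_1), ..., h(W_{n-1})), so it vanishes
  when summed over the facets of a cycle, and O disappears.
*)
theory Submission
  imports Defs
begin

section \<open>Alternating functions and cycles\<close>

text \<open>Transpositions generate the permutations, so alternation has to be checked only on swaps
  of two positions.\<close>

lemma alternating_permute_list:
  fixes \<phi> :: "'a list \<Rightarrow> real"
  assumes swap: "\<And>xs a b. \<lbrakk>length xs = m; a < m; b < m; a \<noteq> b\<rbrakk> \<Longrightarrow>
                   \<phi> (permute_list (Transposition.transpose a b) xs) = - \<phi> xs"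
    and "p permutes {..<m}" "length xs = m"
  shows "\<phi> (permute_list p xs) = of_int (sign p) * \<phi> xs"
  using finite_lessThan assms(2,3)
proof (induction p arbitrary: xs rule: permutes_rev_induct)
  case id
  then show ?case by simp
next
  case (swap a b p)
  have t: "Transposition.transpose a b permutes {..<length xs}"
    using swap by (simp add: permutes_swap_id)
  have "permutation p"
    using swap by (auto simp: permutation_permutes)
  then have sign: "sign (p \<circ> Transposition.transpose a b) = - sign p"
    using swap by (simp add: sign_compose permutation_swap_id sign_swap_id)
  \<comment> \<open>\<open>permute_list\<close> reverses composition: the transposition acts last,
    on the already permuted list.\<close>
  have perm: "\<phi> (permute_list (p \<circ> Transposition.transpose a b) xs) = - \<phi> (permute_list p xs)"
    using swap by (simp add: permute_list_compose[OF t] assms(1))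
  show ?case
    unfolding sign perm using swap by simp
qed

text \<open>Each permutation \<open>p\<close> of the positions carries exactly one list,
  \<open>permute_list (inv p) H\<close>, to \<open>H\<close>, and alternation makes its contribution
  \<open>\<phi> H\<close>. Counting permutations rather than lists also covers an \<open>H\<close>
  with repetitions.\<close>

lemma sum_oriented_coeff:
  fixes \<phi> :: "'a list \<Rightarrow> real"
  assumes alt: "\<And>p. p permutes {..<length H} \<Longrightarrow> \<phi> (permute_list p H) = of_int (sign p) * \<phi> H"
    and fin: "finite \<G>" and sub: "{G. mset G = mset H} \<subseteq> \<G>"
  shows "(\<Sum>G\<in>\<G>. of_int (oriented_coeff G H) * \<phi> G) = fact (length H) * \<phi> H"
proof -
  let ?S = "{p. p permutes {..<length H}}"
  have inverse: "permute_list p G = H \<longleftrightarrow> G = permute_list (inv p) H"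
    if p: "p permutes {..<length H}" for p and G :: "'a list"
  proof
    assume eq: "permute_list p G = H"
    then have len: "length G = length H" by auto
    then show "G = permute_list (inv p) H"
      using p unfolding eq[symmetric]
      by (metis permutes_inv permutes_inv_o(1) permute_list_compose permute_list_id)
  next
    assume "G = permute_list (inv p) H"
    then show "permute_list p G = H"
      using p by (metis permutes_inv_o(2) permute_list_compose permute_list_id)
  qed
  have summand: "of_int (oriented_coeff G H) * \<phi> G = (\<Sum>p | p \<in> ?S \<and> permute_list p G = H. \<phi> H)" for G
  proof -
    have "{p. p permutes {..<length G} \<and> permute_list p G = H} = {p \<in> ?S. permute_list p G = H}"
      by (auto dest: arg_cong[where f = length])
    moreover have "of_int (sign p) * \<phi> G = \<phi> H" if "p \<in> ?S" "permute_list p G = H" for p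
    proof -
      have p: "p permutes {..<length H}" using that by simp
      then have "permutation p" by (auto simp: permutation_permutes)
      moreover have "\<phi> G = of_int (sign (inv p)) * \<phi> H"
        using alt[OF permutes_inv[OF p]] that(2) inverse[OF p] by simp
      ultimately show ?thesis
        by (simp add: sign_inverse flip: mult.assoc of_int_mult)
    qed
    ultimately show ?thesis
      by (simp add: oriented_coeff_def sum_distrib_right)
  qed
  have fS: "finite ?S" by (simp add: finite_permutations)
  have "(\<Sum>G\<in>\<G>. of_int (oriented_coeff G H) * \<phi> G)
      = (\<Sum>p\<in>?S. \<Sum>G | G \<in> \<G> \<and> permute_list p G = H. \<phi> H)"
    unfolding summand by (rule sum.swap_restrict[OF fin fS])
  also have "\<dots> = (\<Sum>p\<in>?S. \<phi> H)"
  proof (rule sum.cong[OF refl])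
    fix p assume p: "p \<in> ?S"
    then have "mset (permute_list (inv p) H) = mset H"
      by (simp add: permutes_inv)
    then have "permute_list (inv p) H \<in> \<G>"
      using sub by auto
    then have "{G \<in> \<G>. permute_list p G = H} = {permute_list (inv p) H}"
      using inverse p by auto
    then show "(\<Sum>G | G \<in> \<G> \<and> permute_list p G = H. \<phi> H) = \<phi> H"
      by simp
  qed
  also have "\<dots> = fact (length H) * \<phi> H"
    by (simp add: card_permutations)
  finally show ?thesis .
qed

text \<open>The sum is the linear extension of \<open>\<phi>\<close> evaluated on the boundary of
  the chain. Summing over all lists \<open>G\<close> meets every ordering of a face; hence the
  auxiliary factor \<open>fact m\<close>, cancelled at the end.\<close>

lemma alternating_sum_over_cycle:
  fixes \<phi> :: "'a list \<Rightarrow> real"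
  assumes cyc: "simplicial_cycle P" and len: "\<forall>F\<in>#P. length F = Suc m"
    and alt: "\<And>p G. \<lbrakk>length G = m; p permutes {..<m}\<rbrakk> \<Longrightarrow>
                \<phi> (permute_list p G) = of_int (sign p) * \<phi> G"
  shows "(\<Sum>F\<in>#P. \<Sum>j<Suc m. (-1) ^ j * \<phi> (take j F @ drop (Suc j) F)) = 0"
proof -
  \<comment> \<open>One finite index set for all facets: it contains every reordering of every face,
    so that the sums over \<open>F\<close> and \<open>G\<close> can be exchanged.\<close>
  define \<G> where "\<G> = {G. set G \<subseteq> (\<Union>F\<in>set_mset P. set F) \<and> length G = m}"
  have fin: "finite \<G>"
    unfolding \<G>_def by (intro finite_lists_length_eq) auto
  have facet: "fact m * (\<Sum>j<Suc m. (-1) ^ j * \<phi> (take j F @ drop (Suc j) F))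
      = (\<Sum>G\<in>\<G>. of_int (boundary_coeff G F) * \<phi> G)" if F: "F \<in># P" for F
  proof -
    have lenF: "length F = Suc m" using len F by auto
    have face: "fact m * \<phi> (take j F @ drop (Suc j) F)
        = (\<Sum>G\<in>\<G>. of_int (oriented_coeff G (take j F @ drop (Suc j) F)) * \<phi> G)"
      if j: "j < Suc m" for j
    proof -
      let ?H = "take j F @ drop (Suc j) F"
      have lH: "length ?H = m" using lenF j by auto
      have "set ?H \<subseteq> set F"
        by (auto dest: in_set_takeD in_set_dropD)
      have "{G. mset G = mset ?H} \<subseteq> \<G>"
      proof safe
        fix G assume G: "mset G = mset ?H"
        then have "set G = set ?H" "length G = m"
          using lH by (metis mset_eq_setD, metis mset_eq_length)
        then show "G \<in> \<G>"
          using \<open>set ?H \<subseteq> set F\<close> F by (auto simp: \<G>_def)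
      qed
      then show ?thesis
        using sum_oriented_coeff[of ?H \<phi> \<G>, OF alt fin] lH by simp
    qed
    have "fact m * (\<Sum>j<Suc m. (-1) ^ j * \<phi> (take j F @ drop (Suc j) F))
        = (\<Sum>j<Suc m. (-1) ^ j * (fact m * \<phi> (take j F @ drop (Suc j) F)))"
      by (simp add: sum_distrib_left mult_ac del: sum.lessThan_Suc)
    also have "\<dots> = (\<Sum>j<Suc m. \<Sum>G\<in>\<G>.
        (-1) ^ j * of_int (oriented_coeff G (take j F @ drop (Suc j) F)) * \<phi> G)"
      by (rule sum.cong[OF refl]) (simp add: face sum_distrib_left mult.assoc)
    also have "\<dots> = (\<Sum>G\<in>\<G>. of_int (boundary_coeff G F) * \<phi> G)"
      by (subst sum.swap)
        (simp add: boundary_coeff_def lenF sum_distrib_right del: sum.lessThan_Suc)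
    finally show ?thesis .
  qed
  have "fact m * (\<Sum>F\<in>#P. \<Sum>j<Suc m. (-1) ^ j * \<phi> (take j F @ drop (Suc j) F))
      = (\<Sum>F\<in>#P. \<Sum>G\<in>\<G>. of_int (boundary_coeff G F) * \<phi> G)"
    using facet by (simp add: sum_mset_distrib_left del: sum.lessThan_Suc cong: image_mset_cong)
  \<comment> \<open>The exchange collects the coefficient of each \<open>G\<close> in the boundary
    of the whole chain, which is 0 for a cycle.\<close>
  also have "\<dots> = (\<Sum>G\<in>\<G>. \<Sum>F\<in>#P. of_int (boundary_coeff G F) * \<phi> G)"
    by (induction P) (simp_all add: sum.distrib)
  also have "\<dots> = (\<Sum>G\<in>\<G>. of_int (\<Sum>F\<in>#P. boundary_coeff G F) * \<phi> G)"
  proof (rule sum.cong[OF refl])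
    fix G
    show "(\<Sum>F\<in>#P. of_int (boundary_coeff G F) * \<phi> G) = of_int (\<Sum>F\<in>#P. boundary_coeff G F) * \<phi> G"
      by (induction P) (simp_all add: distrib_right)
  qed
  also have "\<dots> = 0"
    using cyc by (simp add: simplicial_cycle_def)
  finally show ?thesis
    by simp
qed

section \<open>Determinants of lists of rows\<close>

text \<open>Strict monotonicity gives injectivity, and counting then gives surjectivity. This is the
  dictionary between matrix indices and list positions.\<close>

lemma bij_betw_card_lessThan:
  "bij_betw (\<lambda>i::'n::{finite,linorder}. card {..<i}) UNIV {..<CARD('n)}"
proof -
  have mono: "card {..<i} < card {..<j}" if "i < j" for i j :: 'n
    using that by (intro psubset_card_mono) auto
  have inj: "inj (\<lambda>i::'n. card {..<i})"
    by (rule injI) (metis mono less_irrefl linorder_neqE)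
  have "range (\<lambda>i::'n. card {..<i}) \<subseteq> {..<CARD('n)}"
    by (auto intro!: psubset_card_mono)
  then have "range (\<lambda>i::'n. card {..<i}) = {..<CARD('n)}"
    by (intro card_subset_eq) (auto simp: card_image[OF inj])
  then show ?thesis
    using inj by (simp add: bij_betw_def)
qed

lemma card_lessThan_less [simp]: "card {..<i::'n::{finite,linorder}} < CARD('n)"
  using bij_betwE[OF bij_betw_card_lessThan] by auto

lemma card_lessThan_eq_iff [simp]:
  "card {..<i} = card {..<j} \<longleftrightarrow> i = (j::'n::{finite,linorder})"
  using bij_betw_imp_inj_on[OF bij_betw_card_lessThan] by (auto dest: injD)

lemma set_conv_range_nth:
  fixes xs :: "'a list"
  assumes "length xs = CARD('n::{finite,linorder})"
  shows "set xs = range (\<lambda>i::'n. xs ! card {..<i})"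
proof -
  have "set xs = (!) xs ` {..<CARD('n)}"
    using assms by (auto simp: set_conv_nth)
  also have "\<dots> = (!) xs ` range (\<lambda>i::'n. card {..<i})"
    by (simp add: bij_betw_imp_surj_on[OF bij_betw_card_lessThan])
  finally show ?thesis
    by (simp add: image_image)
qed

text \<open>With the rows in a list, permuting positions and deleting or inserting a vertex act
  directly on determinants.\<close>

definition row_det :: "(real ^ 'n::{finite,linorder}) list \<Rightarrow> real" where
  "row_det xs = det (\<chi> i. xs ! card {..<i})"

lemma row_det_swap:
  fixes xs :: "(real ^ 'n::{finite,linorder}) list"
  assumes len: "length xs = CARD('n)" and "a < CARD('n)" "b < CARD('n)" "a \<noteq> b"
  shows "row_det (permute_list (Transposition.transpose a b) xs) = - row_det xs"
proof -
  have "\<exists>i::'n. card {..<i} = c" if "c < CARD('n)" for c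
    using that bij_betw_imp_surj_on[OF bij_betw_card_lessThan[where 'n='n]] by (metis image_iff lessThan_iff)
  then obtain i j :: 'n where ij: "card {..<i} = a" "card {..<j} = b"
    using assms by meson
  have perm: "Transposition.transpose a b permutes {..<length xs}"
    using assms by (simp add: permutes_swap_id)
  \<comment> \<open>The position map carries the swap of the indices \<open>i\<close>,
    \<open>j\<close> to the swap of the positions \<open>a\<close>, \<open>b\<close>.\<close>
  have idx: "Transposition.transpose a b (card {..<k}) = card {..<Transposition.transpose i j k}" for k
    using ij by (auto simp: Transposition.transpose_def)
  have "row_det (permute_list (Transposition.transpose a b) xs)
      = det (\<chi> k. (\<chi> l. xs ! card {..<l}) $ Transposition.transpose i j k)"
    unfolding row_det_def using len by (simp add: permute_list_nth[OF perm] idx)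
  also have "\<dots> = of_int (sign (Transposition.transpose i j)) * row_det xs"
    unfolding row_det_def by (rule det_permute_rows) (simp add: permutes_swap_id)
  finally show ?thesis
    using ij assms by (auto simp: sign_swap_id)
qed

lemma row_det_swap_adjacent:
  fixes xs :: "(real ^ 'n::{finite,linorder}) list"
  assumes "length (xs @ a # b # ys) = CARD('n)"
  shows "row_det (xs @ a # b # ys) = - row_det (xs @ b # a # ys)"
proof -
  let ?n = "length xs"
  have perm: "Transposition.transpose ?n (Suc ?n) permutes {..<length (xs @ b # a # ys)}"
    by (simp add: permutes_swap_id)
  have "permute_list (Transposition.transpose ?n (Suc ?n)) (xs @ b # a # ys) = xs @ a # b # ys"
  proof (rule nth_equalityI)
    fix i assume "i < length (permute_list (Transposition.transpose ?n (Suc ?n)) (xs @ b # a # ys))"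
    then have i: "i < length (xs @ b # a # ys)" by simp
    consider "i < ?n" | "i = ?n" | "i = Suc ?n" | k where "i = Suc (Suc (?n + k))"
      by (metis add_Suc_right less_antisym less_iff_Suc_add linorder_neqE_nat)
    then show "permute_list (Transposition.transpose ?n (Suc ?n)) (xs @ b # a # ys) ! i = (xs @ a # b # ys) ! i"
      unfolding permute_list_nth[OF perm i]
      by cases (auto simp: nth_append Transposition.transpose_def)
  qed simp
  moreover have "row_det (permute_list (Transposition.transpose ?n (Suc ?n)) (xs @ b # a # ys))
      = - row_det (xs @ b # a # ys)"
    using assms by (intro row_det_swap) auto
  ultimately show ?thesis by simp
qed

text \<open>The row \<open>w\<close> passes \<open>j\<close> rows, one adjacent swap at a time. This
  matches the sign of the \<open>j\<close>-th face in the boundary.\<close>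

lemma row_det_move_to_front:
  fixes ys :: "(real ^ 'n::{finite,linorder}) list"
  assumes "Suc (length ys) = CARD('n)" "j \<le> length ys"
  shows "row_det (take j ys @ w # drop j ys) = (-1) ^ j * row_det (w # ys)"
  using assms(2)
proof (induction j)
  case 0
  then show ?case by simp
next
  case (Suc j)
  have drop: "drop j ys = ys ! j # drop (Suc j) ys"
    using Suc.prems by (simp add: Cons_nth_drop_Suc)
  have "row_det (take (Suc j) ys @ w # drop (Suc j) ys)
      = row_det (take j ys @ ys ! j # w # drop (Suc j) ys)"
    using Suc.prems by (simp add: take_Suc_conv_app_nth)
  also have "\<dots> = - row_det (take j ys @ w # drop j ys)"
    unfolding drop using Suc.prems assms(1) by (intro row_det_swap_adjacent) simp
  finally show ?case
    using Suc by simp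
qed

text \<open>A swap behind the fixed first row is a swap of the full list with positions shifted by
  one. It makes the determinant alternating in the remaining rows.\<close>

lemma row_det_Cons_swap:
  fixes xs :: "(real ^ 'n::{finite,linorder}) list"
  assumes len: "Suc (length xs) = CARD('n)" and ab: "a < length xs" "b < length xs" "a \<noteq> b"
  shows "row_det (w # permute_list (Transposition.transpose a b) xs) = - row_det (w # xs)"
proof -
  have perm: "Transposition.transpose a b permutes {..<length xs}"
    and perm': "Transposition.transpose (Suc a) (Suc b) permutes {..<length (w # xs)}"
    using ab by (simp_all add: permutes_swap_id)
  have "w # permute_list (Transposition.transpose a b) xs = permute_list (Transposition.transpose (Suc a) (Suc b)) (w # xs)"
  proof (rule nth_equalityI)
    fix i assume "i < length (w # permute_list (Transposition.transpose a b) xs)"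
    then have i: "i < length (w # xs)" by simp
    show "(w # permute_list (Transposition.transpose a b) xs) ! i
        = permute_list (Transposition.transpose (Suc a) (Suc b)) (w # xs) ! i"
      unfolding permute_list_nth[OF perm' i] using i
      by (cases i) (auto simp: permute_list_nth[OF perm] Transposition.transpose_def)
  qed simp
  then show ?thesis
    using row_det_swap[of "w # xs" "Suc a" "Suc b"] assms by simp
qed

text \<open>In the multilinear expansion, terms with \<open>q\<close> in two rows vanish, so only
  those with at most one \<open>q\<close> survive. The induction subtracts \<open>q\<close> from one
  row after another.\<close>

lemma det_rows_diff_common:
  fixes a :: "'n::finite \<Rightarrow> real ^ 'n"
  shows "det (\<chi> i. a i - q) = det (\<chi> i. a i) - (\<Sum>j\<in>UNIV. det (\<chi> i. if i = j then q else a i))"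
proof -
  \<comment> \<open>Once row \<open>k\<close> is \<open>q\<close> itself, subtracting
    \<open>q\<close> from other rows is a row operation.\<close>
  have clear: "det (\<chi> i. if i = k then q else if i \<in> S then a i - q else a i)
      = det (\<chi> i. if i = k then q else a i)" if "finite S" "k \<notin> S" for S k
    using that
  proof (induction S)
    case empty
    show ?case by (simp cong: if_cong)
  next
    case (insert l S)
    let ?A = "\<chi> i. if i = k then q else if i \<in> S then a i - q else a i"
    have "det (\<chi> i. if i = l then row l ?A + (-1) *s row k ?A else row i ?A) = det ?A"
      by (rule det_row_operation) (use insert in auto)
    moreover have "(\<chi> i. if i = l then row l ?A + (-1) *s row k ?A else row i ?A)
        = (\<chi> i. if i = k then q else if i \<in> insert l S then a i - q else a i)"
      using insert by (auto simp: vec_eq_iff row_def)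
    ultimately show ?case
      using insert by simp
  qed
  have "det (\<chi> i. if i \<in> S then a i - q else a i)
      = det (\<chi> i. a i) - (\<Sum>j\<in>S. det (\<chi> i. if i = j then q else a i))" if "finite S" for S
    using that
  proof (induction S)
    case (insert k S)
    let ?c = "\<lambda>i. if i \<in> S then a i - q else a i"
    \<comment> \<open>Linearity in row \<open>k\<close>, split as
      \<open>a k = (a k - q) + q\<close>.\<close>
    have "det (\<chi> i. if i = k then a i - q else ?c i) + det (\<chi> i. if i = k then q else ?c i)
        = det (\<chi> i. if i = k then a i else ?c i)"
      using det_row_add[of k "\<lambda>i. a i - q" "\<lambda>i. q" ?c] by (simp cong: if_cong)
    moreover have "(\<lambda>i. if i = k then a i - q else ?c i)
        = (\<lambda>i. if i \<in> insert k S then a i - q else a i)"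
      and "(\<lambda>i. if i = k then a i else ?c i) = ?c"
      using insert by auto
    ultimately show ?case
      using insert clear[of S k] by simp
  qed simp
  from this[of UNIV] show ?thesis by simp
qed

section \<open>Circumcenters\<close>

text \<open>Adjoining a point outside the affine hull keeps affine independence, so the edge vectors
  from \<open>Q\<close> are linearly independent and the matrix has full rank. The position of the
  apex off the facet hyperplanes enters here.\<close>

lemma det_simplex_nonzero:
  fixes F :: "(real ^ 'n::{finite,linorder}) list"
  assumes len: "length F = CARD('n)" and dist: "distinct F"
    and aff: "\<not> affine_dependent (set F)" and Q: "Q \<notin> affine hull set F"
  shows "det (\<chi> i. F ! card {..<i} - Q) \<noteq> 0"
proof
  let ?A = "\<chi> i::'n. F ! card {..<i} - Q"
  assume "det ?A = 0"
  then have "rank ?A < CARD('n)"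
    by (simp add: det_eq_0_rank)
  moreover have "rows ?A = (\<lambda>x. - Q + x) ` set F"
  proof -
    have "row i ?A = F ! card {..<i} - Q" for i
      by (simp add: row_def vec_eq_iff)
    then show ?thesis
      using set_conv_range_nth[OF len] by (auto simp: rows_def)
  qed
  moreover have "Q \<notin> set F"
    using Q hull_inc by metis
  then have "independent ((\<lambda>x. - Q + x) ` set F)"
    using affine_dependent_iff_dependent affine_independent_insert[OF aff Q] by blast
  then have "dim ((\<lambda>x. - Q + x) ` set F) = card (set F)"
    by (simp add: dim_eq_card_independent card_image inj_on_def)
  ultimately show False
    using len dist by (simp add: row_rank_def distinct_card)
qed

text \<open>The shape comes from Cramer's rule: half the squared norms form the right-hand side of
  the circumcenter equations, and it replaces column \<open>k\<close>.\<close>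

definition lift_coord :: "'n \<Rightarrow> real ^ 'n \<Rightarrow> real ^ 'n::finite" where
  "lift_coord k x = (\<chi> j. if j = k then (norm x)\<^sup>2 / 2 else x $ j)"

text \<open>The quadratic term in \<open>c\<close> cancels between the squared distances, leaving a
  linear equation for \<open>c\<close>.\<close>

lemma dist_eq_iff_inner:
  fixes c :: "'a::real_inner"
  shows "dist c v = dist c q \<longleftrightarrow> (v - q) \<bullet> c = ((norm v)\<^sup>2 - (norm q)\<^sup>2) / 2"
proof -
  have "dist c v = dist c q \<longleftrightarrow> (dist c v)\<^sup>2 = (dist c q)\<^sup>2"
    by simp
  also have "\<dots> \<longleftrightarrow> (v - q) \<bullet> c = ((norm v)\<^sup>2 - (norm q)\<^sup>2) / 2"
    by (auto simp: dist_norm power2_norm_eq_inner algebra_simps inner_commute)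
  finally show ?thesis .
qed

text \<open>Equidistance is a linear system with matrix \<open>A\<close>. The denominator
  \<open>det A\<close> in Cramer's rule cancels against the volume, leaving the lifted
  numerator.\<close>

lemma simplex_volume_circumcenter:
  fixes F :: "(real ^ 'n::{finite,linorder}) list"
  assumes len: "length F = CARD('n)" and dist: "distinct F"
    and aff: "\<not> affine_dependent (set F)" and Q: "Q \<notin> affine hull set F"
  shows "simplex_volume Q F * circumcenter (insert Q (set F)) $ k
       = det (\<chi> i. lift_coord k (F ! card {..<i}) - lift_coord k Q) / fact CARD('n)"
proof -
  define A where "A = (\<chi> i::'n. F ! card {..<i} - Q)"
  define b where "b = (\<chi> i::'n. ((norm (F ! card {..<i}))\<^sup>2 - (norm Q)\<^sup>2) / 2)"
  define C where "C = (\<chi> k. det (\<chi> i j. if j = k then b $ i else A $ i $ j) / det A)"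
  have d: "det A \<noteq> 0"
    unfolding A_def by (rule det_simplex_nonzero[OF assms])
  \<comment> \<open>The equivalence gives both existence and uniqueness for the \<open>THE\<close>
    in \<open>circumcenter\<close>. The radius can only be \<open>dist c Q\<close>.\<close>
  have "(\<exists>r. \<forall>v\<in>insert Q (set F). dist c v = r) \<longleftrightarrow> c = C" for c
  proof -
    have "(\<exists>r. \<forall>v\<in>insert Q (set F). dist c v = r) \<longleftrightarrow> (\<forall>v\<in>set F. dist c v = dist c Q)"
      by auto
    also have "\<dots> \<longleftrightarrow> (\<forall>i::'n. dist c (F ! card {..<i}) = dist c Q)"
      using set_conv_range_nth[OF len] by simp
    also have "\<dots> \<longleftrightarrow> A *v c = b"
      by (simp add: dist_eq_iff_inner A_def b_def vec_eq_iff matrix_vector_mult_def inner_vec_def)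
    also have "\<dots> \<longleftrightarrow> c = C"
      unfolding C_def by (rule cramer[OF d])
    finally show ?thesis .
  qed
  then have "circumcenter (insert Q (set F)) = C"
    by (simp add: circumcenter_def)
  moreover have "simplex_volume Q F = det A / fact CARD('n)"
    by (simp add: simplex_volume_def A_def)
  moreover have "(\<chi> i j. if j = k then b $ i else A $ i $ j)
      = (\<chi> i. lift_coord k (F ! card {..<i}) - lift_coord k Q)"
    by (auto simp: vec_eq_iff A_def b_def lift_coord_def diff_divide_distrib)
  ultimately show ?thesis
    using d by (simp add: C_def)
qed

section \<open>Cancellation of the apex over a cycle\<close>

text \<open>Moving \<open>w\<close> to the front turns the inner sum into the value of an
  alternating function on the boundary of \<open>F\<close>.\<close>

lemma sum_det_replace_row_cycle:
  fixes P :: "(real ^ 'n::{finite,linorder}) list multiset"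
    and h :: "real ^ 'n::{finite,linorder} \<Rightarrow> real ^ 'n::{finite,linorder}"
  assumes cyc: "simplicial_cycle P" and len: "\<forall>F\<in>#P. length F = CARD('n)"
  shows "(\<Sum>F\<in>#P. \<Sum>j\<in>UNIV. det (\<chi> i. if i = j then w else h (F ! card {..<i}))) = 0"
proof -
  obtain m where m: "CARD('n) = Suc m"
    using not0_implies_Suc by (metis card_eq_0_iff empty_not_UNIV finite)
  define \<phi> where "\<phi> G = row_det (w # map h G)" for G
  have alt: "\<phi> (permute_list p G) = of_int (sign p) * \<phi> G"
    if "length G = m" "p permutes {..<m}" for p G
  proof (rule alternating_permute_list[OF _ that(2,1)])
    fix xs :: "(real ^ 'n::{finite,linorder}) list" and a b assume "length xs = m" "a < m" "b < m" "a \<noteq> b"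
    then show "\<phi> (permute_list (Transposition.transpose a b) xs) = - \<phi> xs"
      unfolding \<phi>_def using m
      by (simp add: row_det_Cons_swap permutes_swap_id flip: permute_list_map)
  qed
  have "(\<Sum>j\<in>UNIV. det (\<chi> i. if i = j then w else h (F ! card {..<i})))
      = (\<Sum>j<Suc m. (-1) ^ j * \<phi> (take j F @ drop (Suc j) F))" if "F \<in># P" for F
  proof -
    have lenF: "length F = Suc m" using that len m by simp
    have "(\<Sum>j\<in>UNIV. det (\<chi> i. if i = j then w else h (F ! card {..<i})))
        = (\<Sum>j\<in>(UNIV::'n set). row_det ((map h F)[card {..<j} := w]))"
    proof (rule sum.cong[OF refl])
      fix j :: 'n
      have "(map h F)[card {..<j} := w] ! card {..<i} = (if i = j then w else h (F ! card {..<i}))"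
        for i :: 'n
        using card_lessThan_less[of i] lenF m by (auto simp: nth_list_update)
      then show "det (\<chi> i. if i = j then w else h (F ! card {..<i}))
          = row_det ((map h F)[card {..<j} := w])"
        by (simp add: row_det_def)
    qed
    also have "\<dots> = (\<Sum>j<CARD('n). row_det ((map h F)[j := w]))"
      by (rule sum.reindex_bij_betw[OF bij_betw_card_lessThan])
    also have "\<dots> = (\<Sum>j<Suc m. (-1) ^ j * \<phi> (take j F @ drop (Suc j) F))"
      unfolding m
    proof (rule sum.cong[OF refl])
      fix j assume "j \<in> {..<Suc m}"
      then have j: "j < Suc m" by simp
      let ?ys = "map h (take j F @ drop (Suc j) F)"
      \<comment> \<open>Overwriting vertex \<open>j\<close> is the same as deleting it and inserting
        \<open>w\<close> in the gap, so the face opposite that vertex appears.\<close>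
      have "(map h F)[j := w] = take j ?ys @ w # drop j ?ys"
        using j lenF by (simp add: upd_conv_take_nth_drop take_map drop_map)
      also have "row_det \<dots> = (-1) ^ j * row_det (w # ?ys)"
        using j lenF m by (intro row_det_move_to_front) auto
      finally show "row_det ((map h F)[j := w]) = (-1) ^ j * \<phi> (take j F @ drop (Suc j) F)"
        by (simp add: \<phi>_def)
    qed
    finally show ?thesis .
  qed
  then have "(\<Sum>F\<in>#P. \<Sum>j\<in>UNIV. det (\<chi> i. if i = j then w else h (F ! card {..<i})))
      = (\<Sum>F\<in>#P. \<Sum>j<Suc m. (-1) ^ j * \<phi> (take j F @ drop (Suc j) F))"
    by (simp cong: image_mset_cong del: sum.lessThan_Suc)
  also have "\<dots> = 0"
    using alternating_sum_over_cycle[OF cyc _ alt] len m by simp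
  finally show ?thesis .
qed

text \<open>The correction terms of \<open>det_rows_diff_common\<close> cancel over the cycle. The
  map \<open>h\<close> and the vector \<open>q\<close> will be \<open>lift_coord k\<close> and the
  lifted apex.\<close>

lemma sum_det_apex_cycle:
  fixes P :: "(real ^ 'n::{finite,linorder}) list multiset"
    and h :: "real ^ 'n::{finite,linorder} \<Rightarrow> real ^ 'n::{finite,linorder}"
  assumes cyc: "simplicial_cycle P" and len: "\<forall>F\<in>#P. length F = CARD('n)"
  shows "(\<Sum>F\<in>#P. det (\<chi> i. h (F ! card {..<i}) - q)) = (\<Sum>F\<in>#P. det (\<chi> i. h (F ! card {..<i})))"
proof -
  have "(\<Sum>F\<in>#P. det (\<chi> i. h (F ! card {..<i}) - q))
      = (\<Sum>F\<in>#P. det (\<chi> i. h (F ! card {..<i})))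
        - (\<Sum>F\<in>#P. \<Sum>j\<in>UNIV. det (\<chi> i. if i = j then q else h (F ! card {..<i})))"
    by (induction P) (simp_all add: det_rows_diff_common)
  then show ?thesis
    by (simp add: sum_det_replace_row_cycle[OF assms])
qed

theorem theorem6:
  fixes P :: "(real ^ 'n::{finite,linorder}) list multiset"
    and Q Q' :: "real ^ 'n::{finite,linorder}"
  assumes "oriented_simplicial_polyhedron P"
    and "polyhedron_volume P \<noteq> 0"
    and "\<forall>F\<in>#P. Q \<notin> affine hull (set F)"
    and "\<forall>F\<in>#P. Q' \<notin> affine hull (set F)"
  shows "circumcenter_of_mass P Q = circumcenter_of_mass P Q'"
proof -
  have facet: "length F = CARD('n)" "distinct F" "\<not> affine_dependent (set F)" if "F \<in># P" for F
    using assms(1) that by (auto simp: oriented_simplicial_polyhedron_def)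
  have cyc: "simplicial_cycle P"
    using assms(1) by (simp add: oriented_simplicial_polyhedron_def)
  \<comment> \<open>The right-hand side does not contain \<open>R\<close>, so comparing coordinates
    for two apexes finishes the proof.\<close>
  have coord: "circumcenter_of_mass P R $ k
      = (\<Sum>F\<in>#P. det (\<chi> i. lift_coord k (F ! card {..<i}))) / (polyhedron_volume P * fact CARD('n))"
    if R: "\<forall>F\<in>#P. R \<notin> affine hull (set F)" for R k
  proof -
    let ?c = "polyhedron_volume P * fact CARD('n)"
    \<comment> \<open>The volume is replaced by a constant \<open>v\<close>, since induction on
      \<open>P\<close> would otherwise change the denominator as well.\<close>
    have "(\<Sum>F\<in>#P. (simplex_volume R F / v) *\<^sub>R circumcenter (insert R (set F))) $ k
        = (\<Sum>F\<in>#P. simplex_volume R F * circumcenter (insert R (set F)) $ k / v)" for v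
      by (induction P) simp_all
    then have "circumcenter_of_mass P R $ k
        = (\<Sum>F\<in>#P. simplex_volume R F * circumcenter (insert R (set F)) $ k / polyhedron_volume P)"
      unfolding circumcenter_of_mass_def .
    also have "\<dots> = (\<Sum>F\<in>#P. det (\<chi> i. lift_coord k (F ! card {..<i}) - lift_coord k R) / ?c)"
      using R facet by (simp add: simplex_volume_circumcenter mult.commute cong: image_mset_cong)
    also have "\<dots> = (\<Sum>F\<in>#P. det (\<chi> i. lift_coord k (F ! card {..<i}) - lift_coord k R)) / ?c"
      by (simp add: divide_inverse sum_mset_distrib_right)
    finally show ?thesis
      using facet by (simp add: sum_det_apex_cycle[OF cyc])
  qed
  show ?thesis
    using assms(3,4) by (simp add: vec_eq_iff coord)
qed

end
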